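(* Let $n\ge1$, let $a_0,\dots,a_{n-1}\in\mathbb{H}$, let $$A_c=\begin{bmatrix}0&1&\cdots&0\\ \vdots&\vdots&\ddots&\vdots\\ 0&0&\cdots&1\\ -a_0&-a_1&\cdots&-a_{n-1}\end{bmatrix}\in\mathbb{H}^{n\times n},$$ and let $a(\lambda)=a_0+a_1\lambda+\cdots+a_{n-1}\lambda^{n-1}+\lambda^n\in\mathbb{H}[\lambda]$ be the associated companion polynomial. Then: 1. If $\lambda\in\mathbb{H}$ is a right zero of $a$, then $\lambda$ is a right eigenvalue of $A_c$, and $v=[1,\lambda,\dots,\lambda^{n-1}]^{\top}$ satisfies $A_cv=v\lambda$. 2. Consequently, $$\sigma_r(A_c)=\{[\lambda]:\lambda\in\mathbb{H},\ a(\lambda)_r=0\}.$$ Equivalently, if $\lambda_1,\dots,\lambda_m$ are the distinct right zeros of $a$ modulo similarity, then $\sigma_r(A_c)=\{[\lambda_1],\dots,[\lambda_m]\}$. 3. Every left zero $\mu\in\mathbb{H}$ of $a$ is a right eigenvalue of $A_c$.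
   Context: $\mathbb{H}$ denotes the real quaternions (noncommutative). Two quaternions $q,r$ are similar if $q=\alpha^{-1}r\alpha$ for some nonzero $\alpha\in\mathbb{H}$; $[q]$ denotes the similarity class of $q$. In $\mathbb{H}[\lambda]$ the indeterminate commutes with the coefficients. For $p(\lambda)=\sum_k p_k\lambda^k\in\mathbb{H}[\lambda]$ and $q\in\mathbb{H}$, the right and left evaluations are $p(q)_r=\sum_k p_kq^k$ and $p(q)_\ell=\sum_k q^kp_k$. A right zero of $p$ is $q\in\mathbb{H}$ with $p(q)_r=0$; a left zero is $q$ with $p(q)_\ell=0$. For $M\in\mathbb{H}^{n\times n}$, $\lambda\in\mathbb{H}$ is a right eigenvalue of $M$ if there is $v\in\mathbb{H}^n$, $v\ne0$, with $Mv=v\lambda$. The right spectrum is the set of similarity classes $\sigma_r(M)=\{[\lambda]:\exists\, v\neq0,\ Mv=v\lambda\}$. The matrix $A_c$ has rows $e_i^{\top}A_c=e_{i+1}^{\top}$ for $i=1,\dots,n-1$ and last row $[-a_0,\dots,-a_{n-1}]$, where $e_i$ is the $i$-th canonical basis column vector. *)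

theory Defs
  imports
    Complex_Main
    "HOL-Computational_Algebra.Polynomial"
    "Jordan_Normal_Form.Matrix"
begin

datatype quat = Quat (q_re: real) (q_im1: real) (q_im2: real) (q_im3: real)

instantiation quat :: division_ring
begin

definition "0 = Quat 0 0 0 0"
definition "1 = Quat 1 0 0 0"
definition "p + q = Quat (q_re p + q_re q) (q_im1 p + q_im1 q) (q_im2 p + q_im2 q) (q_im3 p + q_im3 q)"
definition "- q = Quat (- q_re q) (- q_im1 q) (- q_im2 q) (- q_im3 q)"
definition "p - q = Quat (q_re p - q_re q) (q_im1 p - q_im1 q) (q_im2 p - q_im2 q) (q_im3 p - q_im3 q)"

definition
  "p * q = Quat
     (q_re p * q_re q - q_im1 p * q_im1 q - q_im2 p * q_im2 q - q_im3 p * q_im3 q)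
     (q_re p * q_im1 q + q_im1 p * q_re q + q_im2 p * q_im3 q - q_im3 p * q_im2 q)
     (q_re p * q_im2 q - q_im1 p * q_im3 q + q_im2 p * q_re q + q_im3 p * q_im1 q)
     (q_re p * q_im3 q + q_im1 p * q_im2 q - q_im2 p * q_im1 q + q_im3 p * q_re q)"

definition
  "inverse q =
     (let N = (q_re q)\<^sup>2 + (q_im1 q)\<^sup>2 + (q_im2 q)\<^sup>2 + (q_im3 q)\<^sup>2
      in Quat (q_re q / N) (- q_im1 q / N) (- q_im2 q / N) (- q_im3 q / N))"

definition "(p::quat) div q = p * inverse q"

lemmas quat_defs = zero_quat_def one_quat_def plus_quat_def uminus_quat_def minus_quat_def
  times_quat_def inverse_quat_def divide_quat_def

lemma quat_norm_sq_nonzero: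
  "q \<noteq> 0 \<Longrightarrow> (q_re q)\<^sup>2 + (q_im1 q)\<^sup>2 + (q_im2 q)\<^sup>2 + (q_im3 q)\<^sup>2 \<noteq> 0"
  by (cases q) (auto simp: zero_quat_def add_nonneg_eq_0_iff)

instance
proof
  fix p q r :: quat
  show "p * q * r = p * (q * r)" "(p + q) * r = p * r + q * r" "p * (q + r) = p * q + p * r"
    by (simp_all add: quat_defs algebra_simps)
  show "q \<noteq> 0 \<Longrightarrow> inverse q * q = 1" "q \<noteq> 0 \<Longrightarrow> q * inverse q = 1"
    using quat_norm_sq_nonzero[of q]
    by (simp_all add: quat_defs Let_def add_divide_distrib[symmetric] diff_divide_distrib[symmetric]
        power2_eq_square mult.commute)
qed (simp_all add: quat_defs)

end

lemma quat_units:
  fixes i j k :: quat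
  defines "i \<equiv> Quat 0 1 0 0" and "j \<equiv> Quat 0 0 1 0" and "k \<equiv> Quat 0 0 0 1"
  shows "i * i = -1" "j * j = -1" "k * k = -1" "i * j * k = -1"
  by (simp_all add: i_def j_def k_def quat_defs)

definition similar_quat :: "quat \<Rightarrow> quat \<Rightarrow> bool" where
  "similar_quat q r \<longleftrightarrow> (\<exists>\<alpha>. \<alpha> \<noteq> 0 \<and> q = inverse \<alpha> * r * \<alpha>)"

definition sim_class :: "quat \<Rightarrow> quat set" where
  "sim_class q = {r. similar_quat r q}"

text \<open>
  Multiplication in \<^typ>\<open>'a poly\<close> and the evaluation function of the library need commutative
  coefficients.  Quaternionic polynomials are used here only through their additive structure and
  coefficients.
\<close>

definition right_eval :: "quat poly \<Rightarrow> quat \<Rightarrow> quat" where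
  "right_eval p q = (\<Sum>k\<le>degree p. coeff p k * q ^ k)"

definition left_eval :: "quat poly \<Rightarrow> quat \<Rightarrow> quat" where
  "left_eval p q = (\<Sum>k\<le>degree p. q ^ k * coeff p k)"

definition right_zero :: "quat poly \<Rightarrow> quat \<Rightarrow> bool" where
  "right_zero p q \<longleftrightarrow> right_eval p q = 0"

definition left_zero :: "quat poly \<Rightarrow> quat \<Rightarrow> bool" where
  "left_zero p q \<longleftrightarrow> left_eval p q = 0"

text \<open>The library's scalar multiplication of vectors multiplies from the left.\<close>

definition right_smult_vec :: "quat vec \<Rightarrow> quat \<Rightarrow> quat vec" where
  "right_smult_vec v q = map_vec (\<lambda>x. x * q) v"

definition right_eigenvector :: "quat mat \<Rightarrow> quat vec \<Rightarrow> quat \<Rightarrow> bool" where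
  "right_eigenvector M v q \<longleftrightarrow>
     v \<in> carrier_vec (dim_row M) \<and> v \<noteq> 0\<^sub>v (dim_row M) \<and> M *\<^sub>v v = right_smult_vec v q"

definition right_eigenvalue :: "quat mat \<Rightarrow> quat \<Rightarrow> bool" where
  "right_eigenvalue M q \<longleftrightarrow> (\<exists>v. right_eigenvector M v q)"

definition right_spectrum :: "quat mat \<Rightarrow> quat set set" where
  "right_spectrum M = {sim_class q |q. right_eigenvalue M q}"

text \<open>Matrix indices start at 0, so the last row has index \<open>n - 1\<close>.\<close>

definition companion_mat :: "nat \<Rightarrow> (nat \<Rightarrow> quat) \<Rightarrow> quat mat" where
  "companion_mat n a =
     mat n n (\<lambda>(i, j). if i = n - 1 then - a j else if j = i + 1 then 1 else 0)"

definition companion_poly :: "nat \<Rightarrow> (nat \<Rightarrow> quat) \<Rightarrow> quat poly" where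
  "companion_poly n a = (\<Sum>k<n. monom (a k) k) + monom 1 n"

definition right_zeros_mod_similarity :: "quat poly \<Rightarrow> quat list \<Rightarrow> bool" where
  "right_zeros_mod_similarity p qs \<longleftrightarrow>
     (\<forall>q \<in> set qs. right_zero p q) \<and>
     (\<forall>i < length qs. \<forall>j < length qs. i \<noteq> j \<longrightarrow> \<not> similar_quat (qs ! i) (qs ! j)) \<and>
     (\<forall>q. right_zero p q \<longrightarrow> (\<exists>r \<in> set qs. similar_quat q r))"

end

theory Submission
  imports Defs
begin

text \<open>
  An eigenvector \<open>v\<close> of the companion matrix to \<open>q\<close> satisfies \<open>v\<^sub>i = u q\<^sup>i\<close> with \<open>u = v\<^sub>0 \<noteq> 0\<close>, and the
  last row says \<open>\<Sum>k. c\<^sub>k u q\<^sup>k = 0\<close>, that is, \<open>u q u\<inverse>\<close> is a right zero.  There are finitely many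
  classes of right zeros because dividing by \<open>\<lambda> - q\<close> on the right turns any other right zero \<open>r\<close> into
  the right zero \<open>(r - q) r (r - q)\<inverse>\<close> of the quotient.  If \<open>q\<close> is a left zero, then
  \<open>q\<^sup>k = \<alpha>\<^sub>k q + \<beta>\<^sub>k\<close> with real \<open>\<alpha>\<^sub>k, \<beta>\<^sub>k\<close>, so \<open>q A + B = 0\<close> for \<open>A = \<Sum>k. \<alpha>\<^sub>k c\<^sub>k\<close> and
  \<open>B = \<Sum>k. \<beta>\<^sub>k c\<^sub>k\<close>, and \<open>u = A\<inverse>\<close> (or \<open>u = 1\<close> if \<open>A = 0\<close>) gives an eigenvector.
\<close>

section \<open>Similarity\<close>

lemma power_conjugate:
  fixes q u :: "'a::division_ring"
  assumes "u \<noteq> 0"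
  shows "(u * q * inverse u) ^ k * u = u * q ^ k"
proof (induction k)
  case (Suc k)
  have "(u * q * inverse u) ^ Suc k * u = u * q * (inverse u * ((u * q * inverse u) ^ k * u))"
    by (simp add: mult.assoc)
  also have "\<dots> = u * q * ((inverse u * u) * q ^ k)"
    using Suc by (simp add: mult.assoc)
  finally show ?case using assms by (simp add: mult.assoc)
qed simp

text \<open>Conjugation is multiplicative, so \<open>u\<close> passes through each power and lands
  next to the coefficient. As \<open>u\<close> is invertible, a vanishing twisted sum means that
  \<open>u * q * inverse u\<close> is a right zero.\<close>

lemma polyfun_conjugate:
  fixes q u :: "'a::division_ring"
  assumes "u \<noteq> 0"
  shows "(\<Sum>k\<le>n. c k * (u * q * inverse u) ^ k) * u = (\<Sum>k\<le>n. c k * u * q ^ k)"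
  unfolding sum_distrib_right
  by (intro sum.cong refl) (metis mult.assoc power_conjugate[OF assms])

lemma similar_quat_conjugate: "u \<noteq> 0 \<Longrightarrow> similar_quat (u * q * inverse u) q"
  \<comment> \<open>The conjugator is \<open>inverse u\<close> because similarity is defined with
    the inverse on the left.\<close>
  unfolding similar_quat_def by (rule exI[of _ "inverse u"]) simp

lemma similar_quat_sym: "similar_quat p q \<Longrightarrow> similar_quat q p"
  unfolding similar_quat_def
proof (elim exE conjE)
  fix u assume u: "u \<noteq> 0" "p = inverse u * q * u"
  have "inverse (inverse u) * p * inverse u = (u * inverse u) * q * (u * inverse u)"
    using u by (simp only: mult.assoc inverse_inverse_eq)
  then have "inverse u \<noteq> 0 \<and> q = inverse (inverse u) * p * inverse u"
    using u(1) by simp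
  then show "\<exists>\<alpha>. \<alpha> \<noteq> 0 \<and> q = inverse \<alpha> * p * \<alpha>" by blast
qed

lemma similar_quat_trans: "similar_quat p q \<Longrightarrow> similar_quat q r \<Longrightarrow> similar_quat p r"
  unfolding similar_quat_def
proof (elim exE conjE)
  fix u w assume "u \<noteq> 0" "p = inverse u * q * u" "w \<noteq> 0" "q = inverse w * r * w"
  then have "w * u \<noteq> 0 \<and> p = inverse (w * u) * r * (w * u)"
    by (simp add: nonzero_inverse_mult_distrib mult.assoc)
  then show "\<exists>\<alpha>. \<alpha> \<noteq> 0 \<and> p = inverse \<alpha> * r * \<alpha>" by blast
qed

lemma sim_class_eqI: "similar_quat p q \<Longrightarrow> sim_class p = sim_class q"
  unfolding sim_class_def using similar_quat_sym similar_quat_trans by blast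

section \<open>Finiteness of the classes of right zeros\<close>

text \<open>Division by \<lambda> - q, with the right value at \<open>q\<close> as remainder. In the
  product b(\<lambda>) (\<lambda> - q) the indeterminate commutes with coefficients, so evaluation
  at \<open>r\<close> leaves \<open>r - q\<close> between \<open>b k\<close> and
  \<open>r ^ k\<close>.\<close>

lemma polyfun_right_division:
  fixes c :: "nat \<Rightarrow> 'a::ring_1"
  shows "\<exists>b. b n = c (Suc n) \<and> (\<forall>r. (\<Sum>k\<le>Suc n. c k * r ^ k)
    = (\<Sum>k\<le>Suc n. c k * q ^ k) + (\<Sum>k\<le>n. b k * (r - q) * r ^ k))"
proof -
  \<comment> \<open>These are the quotient coefficients of Horner's scheme.\<close>
  define b where "b j = (\<Sum>k=Suc j..Suc n. c k * q ^ (k - Suc j))" for j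
  have top: "b n = c (Suc n)" by (simp add: b_def)
  \<comment> \<open>The sum telescopes without commutativity, since powers of \<open>q\<close> stay
    to the left of \<open>r - q\<close> and powers of \<open>r\<close> to its right.\<close>
  have power_diff: "r ^ k - q ^ k = (\<Sum>j<k. q ^ (k - Suc j) * (r - q) * r ^ j)" for r k
  proof (induction k)
    case (Suc k)
    have "(\<Sum>j<k. q ^ (Suc k - Suc j) * (r - q) * r ^ j)
      = (\<Sum>j<k. q * (q ^ (k - Suc j) * (r - q) * r ^ j))"
      by (intro sum.cong refl) (simp add: Suc_diff_Suc flip: mult.assoc power_Suc)
    then have "(\<Sum>j<Suc k. q ^ (Suc k - Suc j) * (r - q) * r ^ j)
      = q * (r ^ k - q ^ k) + (r - q) * r ^ k"
      using Suc by (simp add: sum_distrib_left)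
    then show ?case by (simp add: algebra_simps)
  qed simp
  have "(\<Sum>k\<le>Suc n. c k * r ^ k) = (\<Sum>k\<le>Suc n. c k * q ^ k) + (\<Sum>k\<le>n. b k * (r - q) * r ^ k)" for r
  proof -
    have "(\<Sum>k\<le>Suc n. c k * r ^ k) - (\<Sum>k\<le>Suc n. c k * q ^ k)
      = (\<Sum>k\<le>Suc n. c k * (r ^ k - q ^ k))"
      by (simp only: sum_subtractf right_diff_distrib)
    also have "\<dots> = (\<Sum>k\<le>Suc n. \<Sum>j<k. c k * q ^ (k - Suc j) * (r - q) * r ^ j)"
      by (simp only: power_diff sum_distrib_left mult.assoc)
    \<comment> \<open>The order of summation is exchanged over the triangle j < k \<le> n +
      1.\<close>
    also have "\<dots> = (\<Sum>j\<le>n. \<Sum>k=Suc j..Suc n. c k * q ^ (k - Suc j) * (r - q) * r ^ j)"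
      unfolding sum.Sigma[OF finite_atMost ballI[OF finite_lessThan]]
        sum.Sigma[OF finite_atMost ballI[OF finite_atLeastAtMost]]
      by (rule sum.reindex_bij_witness[of _ "\<lambda>(j, k). (k, j)" "\<lambda>(k, j). (j, k)"]) auto
    also have "\<dots> = (\<Sum>j\<le>n. b j * (r - q) * r ^ j)"
      by (simp only: b_def sum_distrib_right)
    finally show ?thesis
      by (simp only: diff_eq_eq add.commute)
  qed
  with top show ?thesis by blast
qed

text \<open>Induction on the degree: dividing by one zero costs at most one class, and the quotient
  keeps the nonzero leading coefficient.\<close>

lemma finite_sim_class_right_roots:
  assumes "c n \<noteq> 0"
  shows "finite {sim_class q |q. (\<Sum>k\<le>n. c k * q ^ k) = 0}"
  using assms
proof (induction n arbitrary: c)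
  case (Suc n)
  show ?case
  proof (cases "\<exists>q. (\<Sum>k\<le>Suc n. c k * q ^ k) = 0")
    case True
    then obtain q where q: "(\<Sum>k\<le>Suc n. c k * q ^ k) = 0" by blast
    obtain b where b: "b n = c (Suc n)"
      "\<And>r. (\<Sum>k\<le>Suc n. c k * r ^ k) = (\<Sum>k\<le>Suc n. c k * q ^ k) + (\<Sum>k\<le>n. b k * (r - q) * r ^ k)"
      using polyfun_right_division[of n c q] by blast
    let ?B = "{sim_class s |s. (\<Sum>k\<le>n. b k * s ^ k) = 0}"
    have "sim_class r \<in> insert (sim_class q) ?B" if r: "(\<Sum>k\<le>Suc n. c k * r ^ k) = 0" for r
    proof (cases "r = q")
      case False
      \<comment> \<open>The conjugator is the factor left in the middle by the division.\<close>
      define s where "s = (r - q) * r * inverse (r - q)"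
      have "(\<Sum>k\<le>n. b k * s ^ k) * (r - q) = (\<Sum>k\<le>n. b k * (r - q) * r ^ k)"
        using False by (simp add: s_def polyfun_conjugate)
      also have "\<dots> = 0"
        using b(2)[of r] unfolding q r by simp
      finally have "(\<Sum>k\<le>n. b k * s ^ k) = 0"
        using False by simp
      moreover have "sim_class r = sim_class s"
        using False similar_quat_conjugate[of "r - q" r] by (simp add: s_def sim_class_eqI)
      ultimately show ?thesis by blast
    qed simp
    then have "{sim_class q |q. (\<Sum>k\<le>Suc n. c k * q ^ k) = 0} \<subseteq> insert (sim_class q) ?B"
      by blast
    moreover have "finite ?B" using Suc.IH[of b] Suc.prems b(1) by simp
    ultimately show ?thesis by (meson finite_insert finite_subset)
  qed simp
qed simp

section \<open>Powers of a quaternion\<close>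

text \<open>\<open>Quat x 0 0 0\<close> is the real number \<open>x\<close> inside the
  quaternions.\<close>

lemma quat_of_real_commute: "Quat x 0 0 0 * q = q * Quat x 0 0 0"
  by (simp add: quat_defs mult.commute)

text \<open>This is the real quadratic equation of \<open>q\<close>, with trace 2 Re q and the
  squared norm as constant term.\<close>

lemma quat_square:
  "q * q = Quat (2 * q_re q) 0 0 0 * q
    - Quat ((q_re q)\<^sup>2 + (q_im1 q)\<^sup>2 + (q_im2 q)\<^sup>2 + (q_im3 q)\<^sup>2) 0 0 0"
  by (simp add: quat_defs algebra_simps power2_eq_square)

lemma quat_power_linear: "\<exists>x y. q ^ k = Quat x 0 0 0 * q + Quat y 0 0 0"
proof (induction k)
  case 0
  have "q ^ 0 = Quat 0 0 0 0 * q + Quat 1 0 0 0" by (simp add: quat_defs)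
  then show ?case by blast
next
  case (Suc k)
  then obtain x y where "q ^ k = Quat x 0 0 0 * q + Quat y 0 0 0" by blast
  then have "q ^ Suc k = Quat x 0 0 0 * (q * q) + Quat y 0 0 0 * q"
    by (simp add: power_Suc2 distrib_right mult.assoc del: power_Suc)
  also have "\<dots> = Quat (x * (2 * q_re q) + y) 0 0 0 * q
    + Quat (- x * ((q_re q)\<^sup>2 + (q_im1 q)\<^sup>2 + (q_im2 q)\<^sup>2 + (q_im3 q)\<^sup>2)) 0 0 0"
    unfolding quat_square by (simp add: quat_defs algebra_simps)
  finally show ?case by blast
qed

lemma left_root_twisted_right_root:
  fixes c :: "nat \<Rightarrow> quat"
  assumes "(\<Sum>k\<le>n. q ^ k * c k) = 0"
  obtains u where "u \<noteq> 0" and "(\<Sum>k\<le>n. c k * u * q ^ k) = 0"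
proof -
  obtain x y where xy: "\<And>k. q ^ k = Quat (x k) 0 0 0 * q + Quat (y k) 0 0 0"
    using quat_power_linear[of q] by metis
  define A where "A = (\<Sum>k\<le>n. c k * Quat (x k) 0 0 0)"
  define B where "B = (\<Sum>k\<le>n. c k * Quat (y k) 0 0 0)"
  have "q ^ k * c k = q * (c k * Quat (x k) 0 0 0) + c k * Quat (y k) 0 0 0" for k
    unfolding xy distrib_right
    by (simp only: quat_of_real_commute[of _ q] quat_of_real_commute[of _ "c k"] mult.assoc)
  then have left: "q * A + B = 0"
    using assms by (simp add: A_def B_def sum.distrib sum_distrib_left)
  have "c k * u * q ^ k = c k * Quat (x k) 0 0 0 * (u * q) + c k * Quat (y k) 0 0 0 * u" for k u
    unfolding xy distrib_left
    by (metis mult.assoc quat_of_real_commute)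
  \<comment> \<open>The same \<open>A\<close> and \<open>B\<close> govern both sums, as the real
    factors are central.\<close>
  then have right: "(\<Sum>k\<le>n. c k * u * q ^ k) = A * (u * q) + B * u" for u
    by (simp add: A_def B_def sum.distrib sum_distrib_right)
  show thesis
  proof (cases "A = 0")
    case True
    \<comment> \<open>Here \<open>left\<close> forces \<open>B\<close> to vanish too.\<close>
    then show thesis using left right[of 1] that[of 1] by simp
  next
    case False
    have "A * (inverse A * q) + B * inverse A = (q * A + B) * inverse A"
      using False by (simp add: distrib_right mult.assoc flip: mult.assoc[of A])
    then show thesis using False left right[of "inverse A"] that[of "inverse A"] by simp
  qed
qed

section \<open>The companion matrix\<close>

lemma coeff_companion_poly:
  "coeff (companion_poly n a) k = (if k < n then a k else if k = n then 1 else 0)"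
  by (auto simp: companion_poly_def coeff_sum)

lemma degree_companion_poly: "degree (companion_poly n a) = n"
  by (rule antisym) (auto intro: degree_le le_degree simp: coeff_companion_poly)

lemma companion_mat_mult_vec:
  assumes "v \<in> carrier_vec n" and "i < n"
  shows "(companion_mat n a *\<^sub>v v) $ i = (if i = n - 1 then - (\<Sum>k<n. a k * v $ k) else v $ Suc i)"
proof -
  have "(companion_mat n a *\<^sub>v v) $ i
      = (\<Sum>j<n. (if i = n - 1 then - a j else if j = i + 1 then 1 else 0) * v $ j)"
    using assms by (simp add: companion_mat_def scalar_prod_def atLeast0LessThan)
  also have "\<dots> = (if i = n - 1 then - (\<Sum>k<n. a k * v $ k) else v $ Suc i)"
  proof (cases "i = n - 1")
    case True
    then show ?thesis by (simp add: sum_negf)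
  next
    case False
    have "(\<Sum>j<n. (if j = i + 1 then 1 else 0) * v $ j) = (\<Sum>j<n. if j = Suc i then v $ j else 0)"
      by (intro sum.cong) auto
    moreover have "Suc i < n" using False assms(2) by simp
    ultimately show ?thesis using False by simp
  qed
  finally show ?thesis .
qed

text \<open>All rows but the last shift the entries, which for powers is right multiplication by
  \<open>q\<close>; the last row is the hypothesis. The case u = 1 is the vector of plain
  powers.\<close>

lemma companion_mat_powers:
  assumes "(\<Sum>k\<le>n. coeff (companion_poly n a) k * u * q ^ k) = 0"
  shows "companion_mat n a *\<^sub>v vec n (\<lambda>i. u * q ^ i) = right_smult_vec (vec n (\<lambda>i. u * q ^ i)) q"
proof (rule eq_vecI)
  have "(\<Sum>k<n. a k * u * q ^ k) + u * q ^ n = 0"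
    using assms by (simp add: coeff_companion_poly lessThan_Suc_atMost[symmetric])
  then have last: "- (\<Sum>k<n. a k * u * q ^ k) = u * q ^ n"
    by (simp add: minus_unique)
  fix i assume "i < dim_vec (right_smult_vec (vec n (\<lambda>i. u * q ^ i)) q)"
  then have i: "i < n" by (simp add: right_smult_vec_def)
  then show "(companion_mat n a *\<^sub>v vec n (\<lambda>i. u * q ^ i)) $ i
      = right_smult_vec (vec n (\<lambda>i. u * q ^ i)) q $ i"
    using last
    by (auto simp: companion_mat_mult_vec right_smult_vec_def mult.assoc
        simp flip: power_Suc2 simp del: power_Suc)
qed (simp add: right_smult_vec_def companion_mat_def)

lemma right_eigenvalue_companion_mat_iff:
  assumes "n \<ge> 1"
  shows "right_eigenvalue (companion_mat n a) q
    \<longleftrightarrow> (\<exists>u. u \<noteq> 0 \<and> (\<Sum>k\<le>n. coeff (companion_poly n a) k * u * q ^ k) = 0)"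
proof
  assume "right_eigenvalue (companion_mat n a) q"
  then obtain v where v: "v \<in> carrier_vec n" "v \<noteq> 0\<^sub>v n"
    and eigen: "companion_mat n a *\<^sub>v v = right_smult_vec v q"
    by (auto simp: right_eigenvalue_def right_eigenvector_def companion_mat_def)
  have row: "(if i = n - 1 then - (\<Sum>k<n. a k * v $ k) else v $ Suc i) = v $ i * q" if "i < n" for i
    using companion_mat_mult_vec[OF v(1) that, of a] v(1) that eigen by (simp add: right_smult_vec_def)
  \<comment> \<open>The shift rows determine \<open>v\<close> from its first entry, which therefore
    serves as \<open>u\<close>.\<close>
  have pow: "i < n \<Longrightarrow> v $ i = v $ 0 * q ^ i" for i
  proof (induction i)
    case (Suc i)
    then have "i < n" and "i \<noteq> n - 1" by auto
    then have "v $ Suc i = v $ i * q" using row[of i] by simp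
    then show ?case using Suc by (simp add: mult.assoc power_Suc2 del: power_Suc)
  qed simp
  have "v $ 0 \<noteq> 0"
  proof
    assume "v $ 0 = 0"
    then have "v = 0\<^sub>v n" using v(1) pow by (intro eq_vecI) auto
    then show False using v(2) by contradiction
  qed
  moreover have "(\<Sum>k\<le>n. coeff (companion_poly n a) k * v $ 0 * q ^ k) = 0"
  proof -
    have "- (\<Sum>k<n. a k * v $ k) = v $ (n - 1) * q"
      using row[of "n - 1"] assms by simp
    also have "\<dots> = v $ 0 * q ^ n"
      using pow[of "n - 1"] assms by (simp add: mult.assoc flip: power_Suc2)
    finally have "(\<Sum>k<n. a k * v $ k) + v $ 0 * q ^ n = 0"
      by (metis add.right_inverse)
    moreover have "(\<Sum>k<n. a k * v $ k) = (\<Sum>k<n. a k * v $ 0 * q ^ k)"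
      by (intro sum.cong refl) (metis lessThan_iff mult.assoc pow)
    ultimately show ?thesis
      by (simp add: coeff_companion_poly lessThan_Suc_atMost[symmetric])
  qed
  ultimately show "\<exists>u. u \<noteq> 0 \<and> (\<Sum>k\<le>n. coeff (companion_poly n a) k * u * q ^ k) = 0" by blast
next
  assume "\<exists>u. u \<noteq> 0 \<and> (\<Sum>k\<le>n. coeff (companion_poly n a) k * u * q ^ k) = 0"
  then obtain u where u: "u \<noteq> 0" "(\<Sum>k\<le>n. coeff (companion_poly n a) k * u * q ^ k) = 0" by blast
  \<comment> \<open>Entry 0 exists because n \<ge> 1, and it equals \<open>u\<close>.\<close>
  have "vec n (\<lambda>i. u * q ^ i) $ 0 \<noteq> 0\<^sub>v n $ 0" using u(1) assms by simp
  then have "vec n (\<lambda>i. u * q ^ i) \<noteq> 0\<^sub>v n" by metis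
  then have "right_eigenvector (companion_mat n a) (vec n (\<lambda>i. u * q ^ i)) q"
    using companion_mat_powers[OF u(2)] by (simp add: right_eigenvector_def companion_mat_def)
  then show "right_eigenvalue (companion_mat n a) q" by (auto simp: right_eigenvalue_def)
qed

theorem theorem3:
  fixes n :: nat and a :: "nat \<Rightarrow> quat"
  assumes "n \<ge> 1"
  shows
    "(\<forall>q. right_zero (companion_poly n a) q \<longrightarrow>
        right_eigenvalue (companion_mat n a) q \<and>
        companion_mat n a *\<^sub>v vec n (\<lambda>i. q ^ i) = right_smult_vec (vec n (\<lambda>i. q ^ i)) q) \<and>
     right_spectrum (companion_mat n a) = {sim_class q |q. right_zero (companion_poly n a) q} \<and>
     finite {sim_class q |q. right_zero (companion_poly n a) q} \<and>
     (\<forall>qs. right_zeros_mod_similarity (companion_poly n a) qs \<longrightarrow>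
        right_spectrum (companion_mat n a) = sim_class ` set qs) \<and>
     (\<forall>q. left_zero (companion_poly n a) q \<longrightarrow> right_eigenvalue (companion_mat n a) q)"
proof -
  let ?M = "companion_mat n a"
  let ?p = "companion_poly n a"
  have zero: "right_zero ?p q \<longleftrightarrow> (\<Sum>k\<le>n. coeff ?p k * q ^ k) = 0" for q
    by (simp add: right_zero_def right_eval_def degree_companion_poly)
  have part1: "right_eigenvalue ?M q" if "right_zero ?p q" for q
    unfolding right_eigenvalue_companion_mat_iff[OF assms]
    using that by (intro exI[of _ 1]) (simp add: zero)
  have powers: "?M *\<^sub>v vec n (\<lambda>i. q ^ i) = right_smult_vec (vec n (\<lambda>i. q ^ i)) q"
    if "right_zero ?p q" for q
    using companion_mat_powers[of n a 1 q] that by (simp add: zero)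
  have "\<exists>r. right_zero ?p r \<and> sim_class q = sim_class r" if eigenvalue: "right_eigenvalue ?M q" for q
  proof -
    obtain u where u: "u \<noteq> 0" "(\<Sum>k\<le>n. coeff ?p k * u * q ^ k) = 0"
      using eigenvalue right_eigenvalue_companion_mat_iff[OF assms] by blast
    \<comment> \<open>The eigenvalue itself need not be a right zero, but its conjugate by
      \<open>u\<close> is one and has the same class.\<close>
    have "(\<Sum>k\<le>n. coeff ?p k * (u * q * inverse u) ^ k) * u = (\<Sum>k\<le>n. coeff ?p k * u * q ^ k)"
      by (rule polyfun_conjugate[OF u(1)])
    then have "right_zero ?p (u * q * inverse u)" using u by (simp add: zero)
    then show ?thesis using sim_class_eqI[OF similar_quat_conjugate[OF u(1)]] by metis
  qed
  then have spectrum: "right_spectrum ?M = {sim_class q |q. right_zero ?p q}"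
    unfolding right_spectrum_def using part1 by blast
  have fin: "finite {sim_class q |q. right_zero ?p q}"
    unfolding zero by (rule finite_sim_class_right_roots) (simp add: coeff_companion_poly)
  have reps: "right_spectrum ?M = sim_class ` set qs" if "right_zeros_mod_similarity ?p qs" for qs
  proof -
    have "\<And>q. q \<in> set qs \<Longrightarrow> right_zero ?p q"
      and "\<And>q. right_zero ?p q \<Longrightarrow> \<exists>r\<in>set qs. sim_class q = sim_class r"
      using that sim_class_eqI unfolding right_zeros_mod_similarity_def by blast+
    then show ?thesis unfolding spectrum by blast
  qed
  have "right_eigenvalue ?M q" if "left_zero ?p q" for q
  proof -
    have "(\<Sum>k\<le>n. q ^ k * coeff ?p k) = 0"
      using that by (simp add: left_zero_def left_eval_def degree_companion_poly)
    then obtain u where "u \<noteq> 0" "(\<Sum>k\<le>n. coeff ?p k * u * q ^ k) = 0"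
      by (rule left_root_twisted_right_root)
    then show ?thesis using right_eigenvalue_companion_mat_iff[OF assms] by blast
  qed
  then show ?thesis using part1 powers spectrum fin reps by blast
qed

end
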